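(* Let $T_1$ be the path on the vertex set $[n]$, $n\ge 3$, with edges $\{1,2\}$, $\{1,3\}$ and $\{i,i+1\}$ for $3\le i\le n-1$, and let $T_2$ be the path on the vertex set $[n]$, $n\geq 4$, with edges $\{1,2\}$, $\{1,3\}$, $\{2,4\}$ and $\{i,i+1\}$ for $4\le i\le n-1$. Then $S/\operatorname{in}_<(I_{T_1})$ and $S/\operatorname{in}_<(I_{T_2})$ are not complete intersections.
   Context: Let $\mathbb{K}$ be a field, $[n]=\{1,\ldots,n\}$ and $S=\mathbb{K}[x_1,\ldots,x_{n+1}]$. For $1\le i<j\le n$ put $g_{ij}=x_ix_{j+1}-x_jx_{i+1}$. For a finite simple graph $G$ with vertex set $[n]$, the Hankel edge ideal $I_G\subset S$ is the ideal generated by the $g_{ij}$ with $i<j$ and $\{i,j\}\in E(G)$. Let $<$ be the (graded) reverse lexicographic order on $S$ induced by $x_1>\cdots>x_n>x_{n+1}$, and $\operatorname{in}_<(I)$ the initial ideal of $I$ with respect to $<$. For a monomial ideal $I\subset S$, $S/I$ is a complete intersection if the monomials in the unique minimal monomial generating set of $I$ are pairwise relatively prime. *)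

theory Defs
  imports
    "HOL-Library.Poly_Mapping"
    "HOL-Algebra.Ideal"
    "HOL-Algebra.Divisibility"
begin

text \<open>
  Polynomials over \<open>'k\<close> in the variables \<open>x\<^sub>i\<close>, \<open>i\<close> a natural number: finitely supported maps from
  exponent vectors to coefficients, with the convolution product of \<open>Poly_Mapping\<close>.
\<close>

type_synonym expo = "nat \<Rightarrow>\<^sub>0 nat"
type_synonym 'k mpoly = "expo \<Rightarrow>\<^sub>0 'k"

abbreviation monomial :: "expo \<Rightarrow> 'k::field mpoly" where
  "monomial a \<equiv> Poly_Mapping.single a 1"

definition var :: "nat \<Rightarrow> 'k::field mpoly" where
  "var i = monomial (Poly_Mapping.single i 1)"

text \<open>The ring \<open>S = K[x\<^sub>1, \<dots>, x\<^bsub>n+1\<^esub>]\<close>; ideals, divisibility and units are always taken in this ring.\<close>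

definition expos :: "nat \<Rightarrow> expo set" where
  "expos n = {a. Poly_Mapping.keys a \<subseteq> {1..n+1}}"

definition poly_ring :: "nat \<Rightarrow> 'k::field mpoly ring" where
  "poly_ring n = \<lparr>carrier = {p. Poly_Mapping.keys p \<subseteq> expos n},
     monoid.mult = (*), one = 1, zero = 0, add = (+)\<rparr>"

definition monomials :: "nat \<Rightarrow> 'k::field mpoly set" where
  "monomials n = monomial ` expos n"

text \<open>A graph on the vertex set \<open>{1..n}\<close> is given by its set of edges, each edge being a
  two-element set of vertices.\<close>

definition hankel_edge_ideal :: "nat \<Rightarrow> nat set set \<Rightarrow> 'k::field mpoly set" where
  "hankel_edge_ideal n E = Idl\<^bsub>poly_ring n\<^esub>
     {var i * var (j + 1) - var j * var (i + 1) | i j. 1 \<le> i \<and> i < j \<and> j \<le> n \<and> {i, j} \<in> E}"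

definition mdeg :: "expo \<Rightarrow> nat" where
  "mdeg a = (\<Sum>i\<in>Poly_Mapping.keys a. Poly_Mapping.lookup a i)"

text \<open>The order induced by \<open>x\<^sub>1 > x\<^sub>2 > \<dots>\<close>: among monomials of equal degree, the one with the
  larger exponent at the last differing variable is the smaller one.\<close>

definition grevlex_less :: "expo \<Rightarrow> expo \<Rightarrow> bool" where
  "grevlex_less a b \<longleftrightarrow> mdeg a < mdeg b \<or>
     (mdeg a = mdeg b \<and>
      (\<exists>i. Poly_Mapping.lookup a i > Poly_Mapping.lookup b i \<and>
           (\<forall>j>i. Poly_Mapping.lookup a j = Poly_Mapping.lookup b j)))"

text \<open>Meaningful for \<open>p \<noteq> 0\<close> only; see \<open>ex1_lead_expo\<close> below.\<close>

definition lead_expo :: "'k::field mpoly \<Rightarrow> expo" where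
  "lead_expo p = (THE a. a \<in> Poly_Mapping.keys p \<and>
     (\<forall>b\<in>Poly_Mapping.keys p. b \<noteq> a \<longrightarrow> grevlex_less b a))"

definition initial_ideal :: "nat \<Rightarrow> 'k::field mpoly set \<Rightarrow> 'k mpoly set" where
  "initial_ideal n I = Idl\<^bsub>poly_ring n\<^esub> {monomial (lead_expo f) | f. f \<in> I \<and> f \<noteq> 0}"

definition minimal_monomial_gens :: "nat \<Rightarrow> 'k::field mpoly set \<Rightarrow> 'k mpoly set \<Rightarrow> bool" where
  "minimal_monomial_gens n I M \<longleftrightarrow> M \<subseteq> monomials n \<and> Idl\<^bsub>poly_ring n\<^esub> M = I \<and>
     (\<forall>N. N \<subset> M \<longrightarrow> Idl\<^bsub>poly_ring n\<^esub> N \<noteq> I)"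

definition rel_prime :: "nat \<Rightarrow> 'k::field mpoly \<Rightarrow> 'k mpoly \<Rightarrow> bool" where
  "rel_prime n u v \<longleftrightarrow> (\<forall>c\<in>carrier (poly_ring n).
     c divides\<^bsub>poly_ring n\<^esub> u \<and> c divides\<^bsub>poly_ring n\<^esub> v \<longrightarrow> c \<in> Units (poly_ring n))"

text \<open>\<open>S/I\<close> is a complete intersection, for a monomial ideal \<open>I\<close> of \<open>S\<close>. For such \<open>I\<close> the description
  is proper by \<open>ex1_minimal_monomial_gens\<close> below.\<close>

definition quotient_complete_intersection :: "nat \<Rightarrow> 'k::field mpoly set \<Rightarrow> bool" where
  "quotient_complete_intersection n I \<longleftrightarrow>
     pairwise (rel_prime n) (THE M. minimal_monomial_gens n I M)"

definition T1_edges :: "nat \<Rightarrow> nat set set" where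
  "T1_edges n = {{1, 2}, {1, 3}} \<union> {{i, i + 1} | i. 3 \<le> i \<and> i \<le> n - 1}"

definition T2_edges :: "nat \<Rightarrow> nat set set" where
  "T2_edges n = {{1, 2}, {1, 3}, {2, 4}} \<union> {{i, i + 1} | i. 4 \<le> i \<and> i \<le> n - 1}"


subsection \<open>The two definite descriptions are well defined\<close>

lemma mdeg_sup: "finite A \<Longrightarrow> Poly_Mapping.keys a \<subseteq> A \<Longrightarrow> mdeg a = (\<Sum>i\<in>A. Poly_Mapping.lookup a i)"
  unfolding mdeg_def by (rule sum.mono_neutral_left) (auto simp: in_keys_iff)

lemma mdeg_add: "mdeg (a + b) = mdeg a + mdeg b"
proof -
  let ?A = "Poly_Mapping.keys a \<union> Poly_Mapping.keys b"
  have "Poly_Mapping.keys (a + b) \<subseteq> ?A" by (rule Poly_Mapping.keys_add)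
  then show ?thesis
    by (simp add: mdeg_sup[of ?A] lookup_add sum.distrib)
qed

lemma mdeg_eq_0_iff: "mdeg a = 0 \<longleftrightarrow> a = 0"
proof
  assume "mdeg a = 0"
  then have "\<forall>i\<in>Poly_Mapping.keys a. Poly_Mapping.lookup a i = 0"
    unfolding mdeg_def by simp
  then have "\<forall>i. Poly_Mapping.lookup a i = 0" by (auto simp: in_keys_iff)
  then show "a = 0" by (intro poly_mapping_eqI) simp
qed (simp add: mdeg_def)

lemma grevlex_less_irrefl: "\<not> grevlex_less a a"
  by (simp add: grevlex_less_def)

lemma grevlex_less_trans:
  assumes "grevlex_less a b" "grevlex_less b c"
  shows "grevlex_less a c"
proof (cases "mdeg a = mdeg b \<and> mdeg b = mdeg c")
  case False
  then show ?thesis using assms unfolding grevlex_less_def by auto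
next
  case True
  from True assms(1) obtain i where i: "Poly_Mapping.lookup a i > Poly_Mapping.lookup b i"
      "\<And>j. j > i \<Longrightarrow> Poly_Mapping.lookup a j = Poly_Mapping.lookup b j"
    unfolding grevlex_less_def by auto
  from True assms(2) obtain k where k: "Poly_Mapping.lookup b k > Poly_Mapping.lookup c k"
      "\<And>j. j > k \<Longrightarrow> Poly_Mapping.lookup b j = Poly_Mapping.lookup c j"
    unfolding grevlex_less_def by auto
  have "Poly_Mapping.lookup a (max i k) > Poly_Mapping.lookup c (max i k)"
    using i k by (cases i k rule: linorder_cases) (auto simp: max_def)
  moreover have "\<forall>j>max i k. Poly_Mapping.lookup a j = Poly_Mapping.lookup c j"
    using i k by simp
  ultimately show ?thesis using True unfolding grevlex_less_def by auto
qed

lemma grevlex_less_total: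
  assumes "a \<noteq> b"
  shows "grevlex_less a b \<or> grevlex_less b a"
proof -
  let ?D = "{i. Poly_Mapping.lookup a i \<noteq> Poly_Mapping.lookup b i}"
  have "?D \<subseteq> Poly_Mapping.keys a \<union> Poly_Mapping.keys b" by (auto simp: in_keys_iff)
  then have fin: "finite ?D" by (rule finite_subset) simp
  have ne: "?D \<noteq> {}" using assms by (auto intro: poly_mapping_eqI)
  define i where "i = Max ?D"
  have "i \<in> ?D" unfolding i_def using fin ne by (rule Max_in)
  moreover have "\<forall>j>i. Poly_Mapping.lookup a j = Poly_Mapping.lookup b j"
    unfolding i_def using Max_ge[OF fin] by (metis (mono_tags, lifting) leD mem_Collect_eq)
  ultimately show ?thesis unfolding grevlex_less_def
    by (metis (mono_tags, lifting) linorder_neqE_nat mem_Collect_eq)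
qed

lemma ex1_lead_expo:
  fixes p :: "'k::field mpoly"
  assumes "p \<noteq> 0"
  shows "\<exists>!a. a \<in> Poly_Mapping.keys p \<and>
    (\<forall>b\<in>Poly_Mapping.keys p. b \<noteq> a \<longrightarrow> grevlex_less b a)"
proof -
  have "\<exists>a\<in>A. \<forall>b\<in>A. b \<noteq> a \<longrightarrow> grevlex_less b a" if "finite A" "A \<noteq> {}" for A
    using that
  proof (induction rule: finite_ne_induct)
    case (singleton x)
    then show ?case by simp
  next
    case (insert x F)
    then obtain a where a: "a \<in> F" "\<forall>b\<in>F. b \<noteq> a \<longrightarrow> grevlex_less b a" by blast
    then have "x \<noteq> a" using insert by auto
    then consider "grevlex_less x a" | "grevlex_less a x" using grevlex_less_total by blast
    then show ?case
    proof cases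
      case 1
      then show ?thesis using a by blast
    next
      case 2
      then have "\<forall>b\<in>F. grevlex_less b x" using a grevlex_less_trans[of _ a x] by (cases "x = a") auto
      then show ?thesis by blast
    qed
  qed
  then have "\<exists>a\<in>Poly_Mapping.keys p. \<forall>b\<in>Poly_Mapping.keys p. b \<noteq> a \<longrightarrow> grevlex_less b a"
    using assms by simp
  then obtain a where a: "a \<in> Poly_Mapping.keys p"
      "\<forall>b\<in>Poly_Mapping.keys p. b \<noteq> a \<longrightarrow> grevlex_less b a" by blast
  show ?thesis
  proof (rule ex1I[of _ a])
    fix b assume b: "b \<in> Poly_Mapping.keys p \<and>
      (\<forall>c\<in>Poly_Mapping.keys p. c \<noteq> b \<longrightarrow> grevlex_less c b)"
    show "b = a"
    proof (rule ccontr)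
      assume "b \<noteq> a"
      then have "grevlex_less a b" "grevlex_less b a" using a b by auto
      then show False using grevlex_less_trans grevlex_less_irrefl by blast
    qed
  qed (use a in blast)
qed

lemma expos_add: "a \<in> expos n \<Longrightarrow> b \<in> expos n \<Longrightarrow> a + b \<in> expos n"
  using Poly_Mapping.keys_add[of a b] by (auto simp: expos_def)

lemma expos_add_iff: "a + b \<in> expos n \<longleftrightarrow> a \<in> expos n \<and> b \<in> expos n"
proof -
  have "Poly_Mapping.keys (a + b) = Poly_Mapping.keys a \<union> Poly_Mapping.keys b"
    by (auto simp: in_keys_iff lookup_add)
  then show ?thesis by (auto simp: expos_def)
qed

lemma poly_ring_simps [simp]:
  "carrier (poly_ring n) = {p. Poly_Mapping.keys p \<subseteq> expos n}"
  "monoid.mult (poly_ring n) = (*)" "one (poly_ring n) = 1"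
  "zero (poly_ring n) = 0" "add (poly_ring n) = (+)"
  by (simp_all add: poly_ring_def)

lemma keys_mult_expos:
  fixes p q :: "'k::field mpoly"
  assumes "Poly_Mapping.keys p \<subseteq> expos n" "Poly_Mapping.keys q \<subseteq> expos n"
  shows "Poly_Mapping.keys (p * q) \<subseteq> expos n"
  using Poly_Mapping.keys_mult[of p q] assms expos_add by blast

lemma cring_poly_ring: "cring (poly_ring n :: 'k::field mpoly ring)"
proof (rule cringI)
  show "abelian_group (poly_ring n :: 'k mpoly ring)"
  proof (rule abelian_groupI)
    fix x y :: "'k mpoly"
    assume "x \<in> carrier (poly_ring n)" "y \<in> carrier (poly_ring n)"
    then show "x \<oplus>\<^bsub>poly_ring n\<^esub> y \<in> carrier (poly_ring n)"
      using Poly_Mapping.keys_add[of x y] by auto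
  next
    fix x :: "'k mpoly"
    assume "x \<in> carrier (poly_ring n)"
    then show "\<exists>y\<in>carrier (poly_ring n). y \<oplus>\<^bsub>poly_ring n\<^esub> x = \<zero>\<^bsub>poly_ring n\<^esub>"
      by (intro bexI[of _ "- x"]) auto
  qed (auto simp: add_ac)
  show "Group.comm_monoid (poly_ring n :: 'k mpoly ring)"
    by (rule comm_monoidI) (simp_all add: mult_ac keys_mult_expos, simp add: expos_def)
qed (auto simp: algebra_simps)

lemma single_sum_keys:
  fixes p :: "'k::field mpoly"
  shows "p = (\<Sum>a\<in>Poly_Mapping.keys p. Poly_Mapping.single a (Poly_Mapping.lookup p a))"
proof (rule poly_mapping_eqI)
  fix b
  show "Poly_Mapping.lookup p b =
    Poly_Mapping.lookup (\<Sum>a\<in>Poly_Mapping.keys p. Poly_Mapping.single a (Poly_Mapping.lookup p a)) b"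
    by (simp add: lookup_sum lookup_single when_def in_keys_iff)
qed

lemma Idl_monomials:
  fixes B :: "expo set"
  assumes B: "B \<subseteq> expos n"
  shows "Idl\<^bsub>poly_ring n\<^esub> (monomial ` B) =
    {p :: 'k::field mpoly. \<forall>m\<in>Poly_Mapping.keys p. m \<in> expos n \<and> (\<exists>b\<in>B. \<exists>c. m = b + c)}" (is "?L = ?R")
proof
  interpret cring "poly_ring n :: 'k mpoly ring" by (rule cring_poly_ring)
  have *: "x * a \<in> ?R" if a: "a \<in> ?R" and x: "Poly_Mapping.keys x \<subseteq> expos n" for a x :: "'k mpoly"
  proof (clarify, intro conjI)
    fix m assume "m \<in> Poly_Mapping.keys (x * a)"
    then obtain u v where uv: "m = u + v" "u \<in> Poly_Mapping.keys x" "v \<in> Poly_Mapping.keys a"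
      using Poly_Mapping.keys_mult[of x a] by blast
    then obtain b c where "b \<in> B" "v = b + c" "v \<in> expos n" using a by blast
    then show "m \<in> expos n" "\<exists>b\<in>B. \<exists>c. m = b + c"
      using uv x by (auto simp: expos_add_iff intro!: bexI[of _ b] exI[of _ "u + c"] simp: add_ac)
  qed
  have "ideal ?R (poly_ring n)"
  proof (rule idealI)
    show "ring (poly_ring n :: 'k mpoly ring)" ..
    show "subgroup ?R (add_monoid (poly_ring n))"
    proof (rule add.subgroupI)
      show "?R \<noteq> {}" by (auto intro: exI[of _ 0])
      fix p q assume p: "p \<in> ?R" and q: "q \<in> ?R"
      then show "p \<oplus>\<^bsub>poly_ring n\<^esub> q \<in> ?R"
        using Poly_Mapping.keys_add[of p q] by auto
      have "\<ominus>\<^bsub>poly_ring n\<^esub> p = - p"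
        using p by (intro minus_equality) auto
      then show "\<ominus>\<^bsub>poly_ring n\<^esub> p \<in> ?R" using p by auto
    qed auto
  next
    fix a x :: "'k mpoly"
    assume a: "a \<in> ?R" and "x \<in> carrier (poly_ring n)"
    then have "Poly_Mapping.keys x \<subseteq> expos n" by simp
    with a have "x * a \<in> ?R" by (rule *)
    then show "x \<otimes>\<^bsub>poly_ring n\<^esub> a \<in> ?R" unfolding poly_ring_simps .
    then show "a \<otimes>\<^bsub>poly_ring n\<^esub> x \<in> ?R" unfolding poly_ring_simps by (subst mult.commute)
  qed
  moreover have "monomial ` B \<subseteq> ?R"
    using B by (auto intro!: bexI exI[of _ 0])
  ultimately show "?L \<subseteq> ?R" by (rule genideal_minimal)
  have sub: "monomial ` B \<subseteq> carrier (poly_ring n :: 'k mpoly ring)" using B by auto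
  interpret I: ideal ?L "poly_ring n" using sub by (rule genideal_ideal)
  show "?R \<subseteq> ?L"
  proof
    fix p assume p: "p \<in> ?R"
    have term_in: "Poly_Mapping.single m (Poly_Mapping.lookup p m) \<in> ?L"
      if m: "m \<in> Poly_Mapping.keys p" for m
    proof -
      obtain b c where bc: "b \<in> B" "m = b + c" "m \<in> expos n" using p m by blast
      have "(monomial b :: 'k mpoly) \<in> ?L" using genideal_self[OF sub] bc by blast
      moreover have "Poly_Mapping.single c (Poly_Mapping.lookup p m) \<in> carrier (poly_ring n)"
        using bc by (auto simp: expos_add_iff split: if_splits)
      ultimately have "monomial b \<otimes>\<^bsub>poly_ring n\<^esub> Poly_Mapping.single c (Poly_Mapping.lookup p m) \<in> ?L"
        by (rule I.I_r_closed)
      then show ?thesis by (simp add: mult_single bc)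
    qed
    have "(\<Sum>a\<in>A. Poly_Mapping.single a (Poly_Mapping.lookup p a)) \<in> ?L"
      if "finite A" "A \<subseteq> Poly_Mapping.keys p" for A
      using that
    proof (induction rule: finite_induct)
      case empty
      then show ?case using I.zero_closed by simp
    next
      case (insert x F)
      then show ?case using I.a_closed[of "Poly_Mapping.single x (Poly_Mapping.lookup p x)"] term_in by simp
    qed
    from this[of "Poly_Mapping.keys p"] show "p \<in> ?L" using single_sum_keys[of p] by simp
  qed
qed

lemma monomial_in_Idl_iff:
  assumes "B \<subseteq> expos n" "m \<in> expos n"
  shows "(monomial m :: 'k::field mpoly) \<in> Idl\<^bsub>poly_ring n\<^esub> (monomial ` B) \<longleftrightarrow> (\<exists>b\<in>B. \<exists>c. m = b + c)"
  using assms by (simp add: Idl_monomials)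

lemma minimal_monomial_gens_eq:
  fixes I :: "'k::field mpoly set"
  assumes B: "B \<subseteq> expos n" and I: "I = Idl\<^bsub>poly_ring n\<^esub> (monomial ` B)"
  defines "P \<equiv> {a \<in> expos n. monomial a \<in> I \<and> (\<forall>b c. monomial b \<in> I \<and> a = b + c \<longrightarrow> c = 0)}"
  shows "minimal_monomial_gens n I M \<longleftrightarrow> M = monomial ` P"
proof -
  have Psub: "P \<subseteq> expos n" by (auto simp: P_def)
  have below: "\<exists>a\<in>P. \<exists>c. m = a + c" if "m \<in> expos n" "monomial m \<in> I" for m
    using that
  proof (induction "mdeg m" arbitrary: m rule: less_induct)
    case less
    show ?case
    proof (cases "m \<in> P")
      case True
      then show ?thesis by (auto intro!: bexI[of _ m] exI[of _ 0])
    next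
      case False
      then obtain b c where bc: "monomial b \<in> I" "m = b + c" "c \<noteq> 0"
        using less.prems unfolding P_def by blast
      then have "mdeg b < mdeg m" using mdeg_eq_0_iff[of c] by (simp add: mdeg_add)
      moreover have "b \<in> expos n" using bc less.prems by (simp add: expos_add_iff)
      ultimately obtain a d where "a \<in> P" "b = a + d" using less.hyps bc by blast
      then show ?thesis using bc by (auto simp: add.assoc)
    qed
  qed
  have PB: "P \<subseteq> C" if C: "C \<subseteq> expos n" "Idl\<^bsub>poly_ring n\<^esub> (monomial ` C) = I" for C
  proof
    fix a assume a: "a \<in> P"
    then obtain b c where bc: "b \<in> C" "a = b + c"
      using monomial_in_Idl_iff[OF C(1), of a, where 'k='k] C(2) by (auto simp: P_def)
    then have "b \<in> expos n" using C by blast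
    moreover have "\<exists>b'\<in>C. \<exists>c. b = b' + c" using bc by (intro bexI[of _ b] exI[of _ 0]) auto
    ultimately have "(monomial b :: 'k mpoly) \<in> I"
      using monomial_in_Idl_iff[OF C(1), of b, where 'k='k] C(2) by blast
    then have "c = 0" using a bc by (auto simp: P_def)
    then show "a \<in> C" using bc by simp
  qed
  have gen: "Idl\<^bsub>poly_ring n\<^esub> (monomial ` P) = I"
  proof -
    have "(\<exists>b\<in>P. \<exists>c. m = b + c) \<longleftrightarrow> (\<exists>b\<in>B. \<exists>c. m = b + c)" if m: "m \<in> expos n" for m
    proof
      assume "\<exists>b\<in>B. \<exists>c. m = b + c"
      then have "(monomial m :: 'k mpoly) \<in> I" using monomial_in_Idl_iff[OF B m, where 'k='k] I by simp
      then show "\<exists>b\<in>P. \<exists>c. m = b + c" using below m by blast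
    next
      assume "\<exists>b\<in>P. \<exists>c. m = b + c"
      then show "\<exists>b\<in>B. \<exists>c. m = b + c" using PB[OF B I[symmetric]] by blast
    qed
    then show ?thesis unfolding I Idl_monomials[OF Psub] Idl_monomials[OF B] by blast
  qed
  show ?thesis
  proof
    assume M: "minimal_monomial_gens n I M"
    then obtain C where C: "C \<subseteq> expos n" "M = monomial ` C"
      unfolding minimal_monomial_gens_def monomials_def by (auto simp: subset_image_iff)
    then have "P \<subseteq> C" using M PB unfolding minimal_monomial_gens_def by blast
    then have "monomial ` P \<subseteq> M" using C by blast
    then show "M = monomial ` P" using M gen unfolding minimal_monomial_gens_def by blast
  next
    assume M: "M = monomial ` P"
    have "Idl\<^bsub>poly_ring n\<^esub> N \<noteq> I" if N: "N \<subset> M" for N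
    proof
      assume eq: "Idl\<^bsub>poly_ring n\<^esub> N = I"
      obtain C where C: "C \<subseteq> P" "N = monomial ` C" using N M by (auto simp: subset_image_iff psubset_eq)
      then have "P \<subseteq> C" using PB[of C] Psub eq by blast
      then show False using C N M by blast
    qed
    then show "minimal_monomial_gens n I M"
      using M gen Psub unfolding minimal_monomial_gens_def monomials_def by blast
  qed
qed

lemma ex1_minimal_monomial_gens:
  fixes G :: "'k::field mpoly set"
  assumes "G \<subseteq> monomials n"
  shows "\<exists>!M. minimal_monomial_gens n (Idl\<^bsub>poly_ring n\<^esub> G) M"
proof -
  obtain B where B: "B \<subseteq> expos n" "G = monomial ` B"
    using assms unfolding monomials_def by (auto simp: subset_image_iff)
  then have "Idl\<^bsub>poly_ring n\<^esub> G = Idl\<^bsub>poly_ring n\<^esub> (monomial ` B)" by simp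
  note * = minimal_monomial_gens_eq[OF B(1) this]
  show ?thesis by (rule ex1I, rule *[THEN iffD2, OF refl], erule *[THEN iffD1])
qed

end

(*
  For i < j the leading monomial of g_ij is x_(i+1) x_j, so two edges {i,j}, {i,k} with j, k > i give
  two initial monomials of degree 2 sharing the variable x_(i+1). Since I_G is generated in degree 2,
  every monomial of its initial ideal has degree at least 2, so these two are minimal generators.
  Both T_1 and T_2 contain the edges {1,2} and {1,3}.
*)
theory Submission
  imports Defs
begin

lemma mdeg_single [simp]: "mdeg (Poly_Mapping.single i k) = k"
  by (simp add: mdeg_def)

lemma lead_expo_eqI:
  assumes "a \<in> Poly_Mapping.keys p"
    and "\<And>b. b \<in> Poly_Mapping.keys p \<Longrightarrow> b \<noteq> a \<Longrightarrow> grevlex_less b a"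
  shows "lead_expo p = a"
proof -
  have "p \<noteq> 0" using assms(1) by auto
  then show ?thesis
    unfolding lead_expo_def using assms by (intro the1_equality ex1_lead_expo) auto
qed

lemma lead_expo_in_keys: "p \<noteq> 0 \<Longrightarrow> lead_expo p \<in> Poly_Mapping.keys p"
  unfolding lead_expo_def using theI'[OF ex1_lead_expo[of p]] by blast

lemma keys_monomial_diff:
  assumes "a \<noteq> b"
  shows "Poly_Mapping.keys (monomial a - monomial b :: 'k::field mpoly) = {a, b}"
  using assms by (auto simp: in_keys_iff lookup_minus lookup_single when_def split: if_splits)

text \<open>This is \<open>g_ij\<close>, the minor on columns \<open>i\<close> and \<open>j\<close>
  of the 2-by-\<open>n\<close> Hankel matrix with rows \<open>x_1, ..., x_n\<close> and
  \<open>x_2, ..., x_(n+1)\<close>.\<close>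

lemma hankel_minor_eq:
  "var i * var (j + 1) - var j * var (i + 1) =
    (monomial (Poly_Mapping.single i 1 + Poly_Mapping.single (j + 1) 1)
      - monomial (Poly_Mapping.single j 1 + Poly_Mapping.single (i + 1) 1) :: 'k::field mpoly)"
  by (simp add: var_def mult_single)

text \<open>Both exponents have degree 2, and \<open>j + 1\<close> is the last index where they
  differ: since \<open>i + 1 < j + 1\<close>, only \<open>a\<close> involves that variable. In the
  reverse lexicographic order the larger last exponent makes \<open>a\<close> the smaller
  one.\<close>

lemma hankel_minor_expos:
  assumes "i < j"
  defines "a \<equiv> Poly_Mapping.single i (1::nat) + Poly_Mapping.single (j + 1) 1"
    and "b \<equiv> Poly_Mapping.single j (1::nat) + Poly_Mapping.single (i + 1) 1"
  shows "a \<noteq> b" and "grevlex_less a b"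
proof -
  have *: "Poly_Mapping.lookup a (j + 1) > Poly_Mapping.lookup b (j + 1)"
    "\<forall>l>j + 1. Poly_Mapping.lookup a l = Poly_Mapping.lookup b l"
    using assms(1) by (auto simp: a_def b_def lookup_add lookup_single when_def)
  then show "a \<noteq> b" by auto
  have "mdeg a = mdeg b" by (simp add: a_def b_def mdeg_add)
  then show "grevlex_less a b" unfolding grevlex_less_def using * by blast
qed

lemma keys_hankel_minor:
  assumes "i < j"
  shows "Poly_Mapping.keys (var i * var (j + 1) - var j * var (i + 1) :: 'k::field mpoly) =
    {Poly_Mapping.single i 1 + Poly_Mapping.single (j + 1) 1,
     Poly_Mapping.single j 1 + Poly_Mapping.single (i + 1) 1}"
  unfolding hankel_minor_eq by (rule keys_monomial_diff) (rule hankel_minor_expos(1)[OF assms])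

lemma lead_expo_hankel_minor:
  assumes "i < j"
  shows "lead_expo (var i * var (j + 1) - var j * var (i + 1) :: 'k::field mpoly) =
    Poly_Mapping.single j 1 + Poly_Mapping.single (i + 1) 1"
  using hankel_minor_expos(2)[OF assms]
  by (intro lead_expo_eqI) (unfold keys_hankel_minor[OF assms], auto)

lemma hankel_minor_in_carrier:
  assumes "1 \<le> i" "i < j" "j \<le> n"
  shows "(var i * var (j + 1) - var j * var (i + 1) :: 'k::field mpoly) \<in> carrier (poly_ring n)"
  using assms unfolding poly_ring_simps mem_Collect_eq keys_hankel_minor[OF assms(2)]
  by (auto simp: expos_add_iff) (auto simp: expos_def)

text \<open>The polynomials of \<open>S\<close> without terms of degree below 2 form a monomial
  ideal, \<open>?J\<close> in the proof, and every generator \<open>g_ij\<close> lies in it. Leading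
  exponents inherit the bound, being keys.\<close>

lemma keys_hankel_edge_ideal:
  assumes "p \<in> (hankel_edge_ideal n E :: 'k::field mpoly set)" "m \<in> Poly_Mapping.keys p"
  shows "m \<in> expos n" "2 \<le> mdeg m"
proof -
  interpret cring "poly_ring n :: 'k mpoly ring" by (rule cring_poly_ring)
  let ?B = "{a \<in> expos n. 2 \<le> mdeg a}"
  let ?J = "Idl\<^bsub>poly_ring n\<^esub> (monomial ` ?B) :: 'k mpoly set"
  have B: "?B \<subseteq> expos n" by auto
  have "ideal ?J (poly_ring n)" by (rule genideal_ideal) auto
  moreover have "var i * var (j + 1) - var j * var (i + 1) \<in> ?J"
    if ij: "1 \<le> i" "i < j" "j \<le> n" for i j
    unfolding Idl_monomials[OF B]
  proof (intro CollectI ballI conjI)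
    fix m
    assume m: "m \<in> Poly_Mapping.keys (var i * var (j + 1) - var j * var (i + 1) :: 'k mpoly)"
    show "m \<in> expos n" using hankel_minor_in_carrier[OF ij, where 'k='k] m by auto
    moreover have "2 \<le> mdeg m" using m unfolding keys_hankel_minor[OF ij(2)] by (auto simp: mdeg_add)
    ultimately show "\<exists>b\<in>?B. \<exists>c. m = b + c" by (intro bexI[of _ m] exI[of _ 0]) auto
  qed
  ultimately have "hankel_edge_ideal n E \<subseteq> ?J"
    unfolding hankel_edge_ideal_def by (intro genideal_minimal) auto
  then have "p \<in> ?J" using assms by blast
  then show "m \<in> expos n" "2 \<le> mdeg m"
    using assms(2) unfolding Idl_monomials[OF B] by (auto simp: mdeg_add)
qed

text \<open>The variable \<open>var i\<close> is a common divisor and not a unit.\<close>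

lemma not_rel_prime_shared_var:
  assumes "i \<in> {1..n + 1}" "a \<in> expos n" "b \<in> expos n"
  shows "\<not> rel_prime n (monomial (a + Poly_Mapping.single i 1))
    (monomial (b + Poly_Mapping.single i 1) :: 'k::field mpoly)"
proof
  assume rp: "rel_prime n (monomial (a + Poly_Mapping.single i 1))
    (monomial (b + Poly_Mapping.single i 1) :: 'k mpoly)"
  have div: "(var i :: 'k mpoly) divides\<^bsub>poly_ring n\<^esub> monomial (c + Poly_Mapping.single i 1)"
    if "c \<in> expos n" for c
    using that unfolding factor_def
    by (intro bexI[of _ "monomial c"]) (auto simp: var_def mult_single add.commute)
  have "(var i :: 'k mpoly) \<in> carrier (poly_ring n)"
    using assms(1) by (auto simp: var_def expos_def)
  then have "(var i :: 'k mpoly) \<in> Units (poly_ring n)"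
    using rp div assms(2,3) unfolding rel_prime_def by blast
  then obtain q :: "'k mpoly" where "q * var i = 1" unfolding Units_def by auto
  then have "0 \<in> Poly_Mapping.keys (q * var i)" by simp
  \<comment> \<open>Every exponent of a multiple of \<open>var i\<close> contains
    \<open>single i 1\<close>, so the exponent 0 of the constant 1 would have positive
    degree.\<close>
  then obtain u where "0 = u + Poly_Mapping.single i (1::nat)"
    using Poly_Mapping.keys_mult[of q "var i"] by (auto simp: var_def)
  then have "mdeg (u + Poly_Mapping.single i 1) = 0" by (simp add: mdeg_eq_0_iff)
  then show False by (simp add: mdeg_add)
qed

lemma not_complete_intersection_if_two_larger_neighbours:
  assumes "1 \<le> i" "i < j" "i < k" "j \<noteq> k" "j \<le> n" "k \<le> n" "{i, j} \<in> E" "{i, k} \<in> E"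
  shows "\<not> quotient_complete_intersection n
    (initial_ideal n (hankel_edge_ideal n E :: 'k::field mpoly set))"
proof
  interpret cring "poly_ring n :: 'k mpoly ring" by (rule cring_poly_ring)
  let ?H = "hankel_edge_ideal n E :: 'k mpoly set"
  let ?I = "initial_ideal n ?H"
  \<comment> \<open>For \<open>l > i\<close> this is the leading exponent of \<open>g_il\<close>;
    every \<open>?e l\<close> contains the variable \<open>x_(i+1)\<close>.\<close>
  let ?e = "\<lambda>l. Poly_Mapping.single l (1::nat) + Poly_Mapping.single (i + 1) 1"
  define B where "B = lead_expo ` {f \<in> ?H. f \<noteq> 0}"
  have I: "?I = Idl\<^bsub>poly_ring n\<^esub> (monomial ` B)"
    unfolding initial_ideal_def B_def by (rule arg_cong[where f = "genideal _"]) auto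
  have B: "b \<in> expos n" "2 \<le> mdeg b" if "b \<in> B" for b
    using that unfolding B_def by (auto dest: lead_expo_in_keys intro: keys_hankel_edge_ideal)
  then have B_sub: "B \<subseteq> expos n" by blast
  then have B_carrier: "monomial ` B \<subseteq> carrier (poly_ring n :: 'k mpoly ring)" by auto
  have mdeg_I: "2 \<le> mdeg m" if m: "monomial m \<in> ?I" for m
  proof -
    obtain b c where "b \<in> B" "m = b + c" using m unfolding I Idl_monomials[OF B_sub] by auto
    then show ?thesis using B(2)[of b] by (simp add: mdeg_add)
  qed
  \<comment> \<open>The exponents of the initial ideal that are minimal under divisibility, in the
    form of \<open>minimal_monomial_gens_eq\<close>, which makes the definite description
    explicit.\<close>
  define P where "P = {a \<in> expos n. monomial a \<in> ?I \<and>
    (\<forall>b c. monomial b \<in> ?I \<and> a = b + c \<longrightarrow> c = 0)}"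
  have the_gens: "(THE M. minimal_monomial_gens n ?I M) = monomial ` P"
    unfolding P_def using minimal_monomial_gens_eq[OF B_sub I] by (intro the_equality) auto
  have e_in_P: "?e l \<in> P" if l: "i < l" "l \<le> n" "{i, l} \<in> E" for l
  proof -
    let ?g = "var i * var (l + 1) - var l * var (i + 1) :: 'k mpoly"
    have "?g \<in> ?H"
      unfolding hankel_edge_ideal_def using hankel_minor_in_carrier[where 'k='k] l assms(1)
      by (intro subsetD[OF genideal_self]) blast+
    moreover have "?g \<noteq> 0" using keys_hankel_minor[OF l(1), where 'k='k] by auto
    ultimately have "?e l \<in> B"
      unfolding B_def lead_expo_hankel_minor[OF l(1), where 'k='k, symmetric] by blast
    then have "?e l \<in> expos n" "monomial (?e l) \<in> ?I"
      unfolding I using B(1) by (blast intro: subsetD[OF genideal_self[OF B_carrier]])+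
    \<comment> \<open>Here \<open>?e l\<close> has degree 2 while \<open>b\<close> already has
      degree at least 2, so nothing is left for \<open>c\<close>.\<close>
    moreover have "c = 0" if "monomial b \<in> ?I" "?e l = b + c" for b c
    proof -
      have "mdeg b + mdeg c = mdeg (?e l)" using that(2) by (simp add: mdeg_add)
      then show ?thesis using mdeg_I[OF that(1)] mdeg_eq_0_iff[of c] by (simp add: mdeg_add)
    qed
    ultimately show ?thesis unfolding P_def by blast
  qed
  \<comment> \<open>\<open>pairwise\<close> constrains distinct elements only, so the two generators
    have to be told apart.\<close>
  have neq: "(monomial (?e j) :: 'k mpoly) \<noteq> monomial (?e k)"
  proof
    assume "(monomial (?e j) :: 'k mpoly) = monomial (?e k)"
    then have "Poly_Mapping.keys (monomial (?e j) :: 'k mpoly) = Poly_Mapping.keys (monomial (?e k) :: 'k mpoly)"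
      by simp
    \<comment> \<open>A monomial has its exponent as only key, and the common summand
      \<open>single (i + 1) 1\<close> cancels.\<close>
    then have "Poly_Mapping.single j (1::nat) = Poly_Mapping.single k 1" by simp
    then have "Poly_Mapping.keys (Poly_Mapping.single j (1::nat)) = Poly_Mapping.keys (Poly_Mapping.single k (1::nat))"
      by simp
    then show False using assms(4) by simp
  qed
  assume "quotient_complete_intersection n ?I"
  then have "pairwise (rel_prime n) (monomial ` P :: 'k mpoly set)"
    unfolding quotient_complete_intersection_def the_gens .
  then have "rel_prime n (monomial (?e j)) (monomial (?e k) :: 'k mpoly)"
    using imageI[OF e_in_P[OF assms(2,5,7)]] imageI[OF e_in_P[OF assms(3,6,8)]] neq
    by (rule pairwiseD(1))
  moreover have "Poly_Mapping.single j 1 \<in> expos n" "Poly_Mapping.single k 1 \<in> expos n"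
    using assms by (auto simp: expos_def)
  \<comment> \<open>The shared variable is \<open>x_(i+1)\<close>. The case
    \<open>j = i + 1\<close>, where \<open>?e j\<close> is the exponent of a square, is covered: one
    factor is split off and the other stays in \<open>single j 1\<close>.\<close>
  ultimately show False
    using not_rel_prime_shared_var[of "i + 1" n, where 'k='k] assms(2,5) by simp
qed

theorem corollary3p5:
  shows "(\<forall>n\<ge>3. \<not> quotient_complete_intersection n
            (initial_ideal n (hankel_edge_ideal n (T1_edges n) :: 'k::field mpoly set))) \<and>
         (\<forall>n\<ge>4. \<not> quotient_complete_intersection n
            (initial_ideal n (hankel_edge_ideal n (T2_edges n) :: 'k::field mpoly set)))"
proof -
  have "{1, 2} \<in> T1_edges n" "{1, 3} \<in> T1_edges n" "{1, 2} \<in> T2_edges n" "{1, 3} \<in> T2_edges n" for n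
    by (simp_all add: T1_edges_def T2_edges_def)
  then show ?thesis
    \<comment> \<open>Vertex 1 has the larger neighbours 2 and 3 in both trees, and both bounds on
      \<open>n\<close> give \<open>3 \<le> n\<close>.\<close>
    by (intro conjI allI impI not_complete_intersection_if_two_larger_neighbours[of 1 2 3]) simp_all
qed

end
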